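(* Let $\mathcal{M}$ be an o-minimal structure and let $G$ be an abelian group definable in $\mathcal{M}$. Then $G$ is monogenic if and only if both $G^0$ and $G/G^0$ are monogenic.
   Context: "Definable" means definable with parameters in $\mathcal{M}$. $G^0$ denotes the smallest definable subgroup of finite index of $G$ (the definably connected component of the identity). For $X \subseteq G$, $\langle X \rangle_{\mathrm{def}}$ is the smallest definable subgroup containing $X$; a definable group $G$ is monogenic if $G = \langle g \rangle_{\mathrm{def}}$ for some $g\in G$ (for the finite group $G/G^0$ this means it is generated by one element). *)

theory Defs
  imports "HOL-Algebra.Elementary_Groups"
begin

text \<open>First-order formulas over a language of ordered structures: equality and the order are
  logical atoms, the remaining vocabulary is arbitrary.\<close>

datatype 'f tm = Var nat | Fun 'f "'f tm list"

datatype ('f, 'r) fm =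
    Eq "'f tm" "'f tm"
  | Less "'f tm" "'f tm"
  | Rel 'r "'f tm list"
  | Neg "('f, 'r) fm"
  | Conj "('f, 'r) fm" "('f, 'r) fm"
  | Exi nat "('f, 'r) fm"

text \<open>The universe of a structure is the whole type \<^typ>\<open>'a\<close>, ordered by its \<^class>\<open>linorder\<close>
  instance. A pair in \<open>funs\<close> or \<open>rels\<close> is a symbol of the language with its arity; the
  interpretations are only ever applied to argument lists of that length.\<close>

record ('f, 'r, 'a) ordered_structure =
  funs :: "('f \<times> nat) set"
  rels :: "('r \<times> nat) set"
  fun_interp :: "'f \<Rightarrow> 'a list \<Rightarrow> 'a"
  rel_interp :: "'r \<Rightarrow> 'a list \<Rightarrow> bool"

fun wf_tm :: "('f, 'r, 'a) ordered_structure \<Rightarrow> 'f tm \<Rightarrow> bool" where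
  "wf_tm M (Var i) = True"
| "wf_tm M (Fun f ts) = ((f, length ts) \<in> funs M \<and> (\<forall>t\<in>set ts. wf_tm M t))"

fun wf_fm :: "('f, 'r, 'a) ordered_structure \<Rightarrow> ('f, 'r) fm \<Rightarrow> bool" where
  "wf_fm M (Eq s t) = (wf_tm M s \<and> wf_tm M t)"
| "wf_fm M (Less s t) = (wf_tm M s \<and> wf_tm M t)"
| "wf_fm M (Rel r ts) = ((r, length ts) \<in> rels M \<and> (\<forall>t\<in>set ts. wf_tm M t))"
| "wf_fm M (Neg \<phi>) = wf_fm M \<phi>"
| "wf_fm M (Conj \<phi> \<psi>) = (wf_fm M \<phi> \<and> wf_fm M \<psi>)"
| "wf_fm M (Exi i \<phi>) = wf_fm M \<phi>"

fun tm_val :: "('f, 'r, 'a) ordered_structure \<Rightarrow> (nat \<Rightarrow> 'a) \<Rightarrow> 'f tm \<Rightarrow> 'a" where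
  "tm_val M e (Var i) = e i"
| "tm_val M e (Fun f ts) = fun_interp M f (map (tm_val M e) ts)"

fun sat :: "('f, 'r, 'a::linorder) ordered_structure \<Rightarrow> (nat \<Rightarrow> 'a) \<Rightarrow> ('f, 'r) fm \<Rightarrow> bool" where
  "sat M e (Eq s t) = (tm_val M e s = tm_val M e t)"
| "sat M e (Less s t) = (tm_val M e s < tm_val M e t)"
| "sat M e (Rel r ts) = rel_interp M r (map (tm_val M e) ts)"
| "sat M e (Neg \<phi>) = (\<not> sat M e \<phi>)"
| "sat M e (Conj \<phi> \<psi>) = (sat M e \<phi> \<and> sat M e \<psi>)"
| "sat M e (Exi i \<phi>) = (\<exists>a. sat M (e(i := a)) \<phi>)"

text \<open>Points of the \<open>n\<close>-th cartesian power are lists of length \<open>n\<close>. Variables below \<open>n\<close> stand for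
  the coordinates; the values of \<open>e\<close> at the remaining variables are the parameters, of which a
  formula uses only finitely many.\<close>

definition definable ::
    "('f, 'r, 'a::linorder) ordered_structure \<Rightarrow> nat \<Rightarrow> 'a list set \<Rightarrow> bool" where
  "definable M n X \<longleftrightarrow>
     (\<exists>\<phi> e. wf_fm M \<phi> \<and>
        X = {xs. length xs = n \<and> sat M (\<lambda>i. if i < n then xs ! i else e i) \<phi>})"

definition point_or_interval :: "'a::linorder set \<Rightarrow> bool" where
  "point_or_interval I \<longleftrightarrow>
     (\<exists>a. I = {a}) \<or> (\<exists>a b. I = {a<..<b}) \<or> (\<exists>a. I = {a<..}) \<or> (\<exists>b. I = {..<b}) \<or> I = UNIV"

definition o_minimal :: "('f, 'r, 'a::linorder) ordered_structure \<Rightarrow> bool" where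
  "o_minimal M \<longleftrightarrow>
     (\<forall>X. definable M 1 X \<longrightarrow>
        (\<exists>\<I>. finite \<I> \<and> (\<forall>I\<in>\<I>. point_or_interval I) \<and> X = (\<lambda>a. [a]) ` \<Union>\<I>))"

definition definable_group ::
    "('f, 'r, 'a::linorder) ordered_structure \<Rightarrow> nat \<Rightarrow> 'a list monoid \<Rightarrow> bool" where
  "definable_group M n G \<longleftrightarrow>
     group G \<and> definable M n (carrier G) \<and>
     definable M (3 * n) {x @ y @ (x \<otimes>\<^bsub>G\<^esub> y) | x y. x \<in> carrier G \<and> y \<in> carrier G}"

definition definable_subgroup ::
    "('f, 'r, 'a::linorder) ordered_structure \<Rightarrow> nat \<Rightarrow> 'a list monoid \<Rightarrow> 'a list set \<Rightarrow> bool" where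
  "definable_subgroup M n G H \<longleftrightarrow> subgroup H G \<and> definable M n H"

text \<open>\<open>H\<close> is the smallest definable subgroup of finite index of \<open>G\<close>. This characterizes \<open>H\<close>
  uniquely.\<close>

definition is_definable_component ::
    "('f, 'r, 'a::linorder) ordered_structure \<Rightarrow> nat \<Rightarrow> 'a list monoid \<Rightarrow> 'a list set \<Rightarrow> bool" where
  "is_definable_component M n G H \<longleftrightarrow>
     definable_subgroup M n G H \<and> finite (rcosets\<^bsub>G\<^esub> H) \<and>
     (\<forall>K. definable_subgroup M n G K \<and> finite (rcosets\<^bsub>G\<^esub> K) \<longrightarrow> H \<subseteq> K)"

text \<open>\<open>H\<close> is the smallest definable subgroup of \<open>G\<close> containing \<open>X\<close>.\<close>

definition is_definable_hull ::
    "('f, 'r, 'a::linorder) ordered_structure \<Rightarrow> nat \<Rightarrow> 'a list monoid \<Rightarrow>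
     'a list set \<Rightarrow> 'a list set \<Rightarrow> bool" where
  "is_definable_hull M n G X H \<longleftrightarrow>
     definable_subgroup M n G H \<and> X \<subseteq> H \<and>
     (\<forall>K. definable_subgroup M n G K \<and> X \<subseteq> K \<longrightarrow> H \<subseteq> K)"

definition monogenic ::
    "('f, 'r, 'a::linorder) ordered_structure \<Rightarrow> nat \<Rightarrow> 'a list monoid \<Rightarrow> bool" where
  "monogenic M n G \<longleftrightarrow> (\<exists>g\<in>carrier G. is_definable_hull M n G {g} (carrier G))"

end

theory Submission
  imports Defs
begin

text \<open>Let \<open>H\<close> be a definable subgroup and \<open>g\<close> an element with \<open>g\<^sup>k \<in> H\<close>, \<open>k > 0\<close>. The subgroup generated
  by \<open>H\<close> and \<open>g\<close> is a union of \<open>k\<close> cosets of \<open>H\<close>, hence definable. If \<open>g\<close> generates \<open>G\<close>, this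
  yields at once that \<open>G/G0\<close> is generated by the coset of \<open>g\<close> and, with \<open>g\<^sup>k \<in> G0\<close>, that \<open>G0\<close> is
  generated by \<open>g\<^sup>k\<close>. Conversely, let \<open>h\<close> generate \<open>G0\<close> and let the coset of \<open>g\<close> generate
  \<open>G/G0\<close>. Then \<open>G0\<close> is divisible: the \<open>k\<close>-th powers have finite index in it, since together with \<open>h\<close>
  they generate it. So \<open>u\<^sup>k = h g\<^sup>-\<^sup>k\<close> for some \<open>u \<in> G0\<close>, and \<open>u g\<close>, whose \<open>k\<close>-th power is \<open>h\<close>,
  generates \<open>G\<close>.\<close>

subsection \<open>Closure properties of definable sets\<close>

fun rename_tm :: "(nat \<Rightarrow> nat) \<Rightarrow> 'f tm \<Rightarrow> 'f tm" where
  "rename_tm \<sigma> (Var i) = Var (\<sigma> i)"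
| "rename_tm \<sigma> (Fun f ts) = Fun f (map (rename_tm \<sigma>) ts)"

fun rename_fm :: "(nat \<Rightarrow> nat) \<Rightarrow> ('f, 'r) fm \<Rightarrow> ('f, 'r) fm" where
  "rename_fm \<sigma> (Eq s t) = Eq (rename_tm \<sigma> s) (rename_tm \<sigma> t)"
| "rename_fm \<sigma> (Less s t) = Less (rename_tm \<sigma> s) (rename_tm \<sigma> t)"
| "rename_fm \<sigma> (Rel r ts) = Rel r (map (rename_tm \<sigma>) ts)"
| "rename_fm \<sigma> (Neg \<phi>) = Neg (rename_fm \<sigma> \<phi>)"
| "rename_fm \<sigma> (Conj \<phi> \<psi>) = Conj (rename_fm \<sigma> \<phi>) (rename_fm \<sigma> \<psi>)"
| "rename_fm \<sigma> (Exi i \<phi>) = Exi (\<sigma> i) (rename_fm \<sigma> \<phi>)"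

lemma wf_tm_rename [simp]: "wf_tm M (rename_tm \<sigma> t) \<longleftrightarrow> wf_tm M t"
  by (induction t) auto

lemma wf_fm_rename [simp]: "wf_fm M (rename_fm \<sigma> \<phi>) \<longleftrightarrow> wf_fm M \<phi>"
  by (induction \<phi>) auto

lemma tm_val_rename: "tm_val M e (rename_tm \<sigma> t) = tm_val M (e \<circ> \<sigma>) t"
  by (induction t) (auto simp: comp_def cong: map_cong)

text \<open>The renaming also affects bound variables. Injectivity rules out capture: at a
  quantifier, updating the value at \<open>\<sigma> i\<close> must change the value seen by the
  variable \<open>i\<close> and by no other.\<close>

lemma sat_rename:
  assumes "inj \<sigma>"
  shows "sat M e (rename_fm \<sigma> \<phi>) \<longleftrightarrow> sat M (e \<circ> \<sigma>) \<phi>"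
proof (induction \<phi> arbitrary: e)
  case (Rel r ts)
  show ?case
    by (simp add: comp_def tm_val_rename)
next
  case (Exi i \<phi>)
  have upd: "e(\<sigma> i := a) \<circ> \<sigma> = (e \<circ> \<sigma>)(i := a)" for a
    using assms by (auto simp: fun_eq_iff inj_def)
  show ?case
    by (simp only: rename_fm.simps sat.simps Exi.IH upd)
qed (simp_all add: tm_val_rename)

section \<open>Boolean operations, fibres, projections and coordinate changes\<close>

lemma definable_length: "definable M n X \<Longrightarrow> xs \<in> X \<Longrightarrow> length xs = n"
  by (auto simp: definable_def)

lemma definable_empty: "definable M n {}"
  unfolding definable_def
  by (rule exI[of _ "Neg (Eq (Var 0) (Var 0))"]) simp

lemma definable_Diff_lists:
  assumes "definable M n X"
  shows "definable M n ({xs. length xs = n} - X)"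
proof -
  obtain \<phi> e where "wf_fm M \<phi>"
    and "X = {xs. length xs = n \<and> sat M (\<lambda>i. if i < n then xs ! i else e i) \<phi>}"
    using assms by (auto simp: definable_def)
  then show ?thesis
    unfolding definable_def by (intro exI[of _ "Neg \<phi>"] exI[of _ e]) auto
qed

lemma definable_Int:
  assumes "definable M n X" and "definable M n Y"
  shows "definable M n (X \<inter> Y)"
proof -
  obtain \<phi> d where \<phi>: "wf_fm M \<phi>"
    and X: "X = {xs. length xs = n \<and> sat M (\<lambda>i. if i < n then xs ! i else d i) \<phi>}"
    using assms(1) by (auto simp: definable_def)
  obtain \<psi> e where \<psi>: "wf_fm M \<psi>"
    and Y: "Y = {xs. length xs = n \<and> sat M (\<lambda>i. if i < n then xs ! i else e i) \<psi>}"
    using assms(2) by (auto simp: definable_def)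
  \<comment> \<open>The parameters of the two formulas are interleaved.\<close>
  define \<sigma> where "\<sigma> i = (if i < n then i else n + 2 * (i - n))" for i
  define \<tau> where "\<tau> i = (if i < n then i else n + (2 * (i - n) + 1))" for i
  define c where "c i = (if even (i - n) then d (n + (i - n) div 2) else e (n + (i - n) div 2))" for i
  have "inj \<sigma>" "inj \<tau>"
    unfolding inj_def \<sigma>_def \<tau>_def by (auto split: if_splits)
  moreover have "(\<lambda>i. if i < n then xs ! i else c i) \<circ> \<sigma> = (\<lambda>i. if i < n then xs ! i else d i)"
    and "(\<lambda>i. if i < n then xs ! i else c i) \<circ> \<tau> = (\<lambda>i. if i < n then xs ! i else e i)" for xs
    by (auto simp: fun_eq_iff \<sigma>_def \<tau>_def c_def)
  ultimately have "X \<inter> Y = {xs. length xs = n \<and>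
      sat M (\<lambda>i. if i < n then xs ! i else c i) (Conj (rename_fm \<sigma> \<phi>) (rename_fm \<tau> \<psi>))}"
    unfolding X Y by (auto simp: sat_rename)
  moreover have "wf_fm M (Conj (rename_fm \<sigma> \<phi>) (rename_fm \<tau> \<psi>))"
    using \<phi> \<psi> by simp
  ultimately show ?thesis
    unfolding definable_def by blast
qed

lemma definable_Un:
  assumes "definable M n X" and "definable M n Y"
  shows "definable M n (X \<union> Y)"
proof -
  let ?L = "{xs. length xs = n}"
  have "X \<union> Y = ?L - ((?L - X) \<inter> (?L - Y))"
    using assms definable_length by blast
  then show ?thesis
    using assms by (simp add: definable_Diff_lists definable_Int)
qed

lemma definable_UN:
  assumes "finite I" and "\<And>i. i \<in> I \<Longrightarrow> definable M n (X i)"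
  shows "definable M n (\<Union>i\<in>I. X i)"
  using assms by (induction I) (simp_all add: definable_empty definable_Un)

text \<open>The formula stays the same: the variables from \<open>m\<close> to
  \<open>m + n - 1\<close> stop being coordinates and become parameters with the values
  \<open>ys\<close>.\<close>

lemma definable_fibre:
  assumes "definable M (m + n) X" and "length ys = n"
  shows "definable M m {xs. length xs = m \<and> xs @ ys \<in> X}"
proof -
  obtain \<phi> e where \<phi>: "wf_fm M \<phi>"
    and X: "X = {xs. length xs = m + n \<and> sat M (\<lambda>i. if i < m + n then xs ! i else e i) \<phi>}"
    using assms(1) by (auto simp: definable_def)
  have "(\<lambda>i. if i < m + n then (xs @ ys) ! i else e i) =
      (\<lambda>i. if i < m then xs ! i else if i < m + n then ys ! (i - m) else e i)"
    if "length xs = m" for xs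
    using that by (auto simp: fun_eq_iff nth_append)
  then have "{xs. length xs = m \<and> xs @ ys \<in> X} = {xs. length xs = m \<and>
      sat M (\<lambda>i. if i < m then xs ! i else if i < m + n then ys ! (i - m) else e i) \<phi>}"
    using assms(2) by (auto simp: X)
  then show ?thesis
    unfolding definable_def using \<phi>
    by (intro exI[of _ \<phi>] exI[of _ "\<lambda>i. if i < m + n then ys ! (i - m) else e i"]) simp
qed

text \<open>The last coordinate is the variable \<open>m\<close>, so it is enough to quantify over
  it; the parameter that \<open>e\<close> would supply there is overwritten by the
  quantifier.\<close>

lemma definable_projection1:
  assumes "definable M (Suc m) X"
  shows "definable M m {xs. length xs = m \<and> (\<exists>a. xs @ [a] \<in> X)}"
proof -
  obtain \<phi> e where \<phi>: "wf_fm M \<phi>"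
    and X: "X = {xs. length xs = Suc m \<and> sat M (\<lambda>i. if i < Suc m then xs ! i else e i) \<phi>}"
    using assms by (auto simp: definable_def)
  have "(\<lambda>i. if i < Suc m then (xs @ [a]) ! i else e i) =
      (\<lambda>i. if i < m then xs ! i else e i)(m := a)" if "length xs = m" for xs a
    using that by (auto simp: fun_eq_iff nth_append)
  then have "{xs. length xs = m \<and> (\<exists>a. xs @ [a] \<in> X)} =
      {xs. length xs = m \<and> sat M (\<lambda>i. if i < m then xs ! i else e i) (Exi m \<phi>)}"
    by (auto simp: X)
  moreover have "wf_fm M (Exi m \<phi>)"
    using \<phi> by simp
  ultimately show ?thesis
    unfolding definable_def by blast
qed

text \<open>The induction hypothesis is applied in dimension \<open>Suc m\<close> to remove the last
  \<open>n\<close> coordinates, which is why \<open>m\<close> is arbitrary; one single projection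
  then remains.\<close>

lemma definable_projection:
  assumes "definable M (m + n) X"
  shows "definable M m {xs. length xs = m \<and> (\<exists>ys. length ys = n \<and> xs @ ys \<in> X)}"
  using assms
proof (induction n arbitrary: m)
  case 0
  then have "{xs. length xs = m \<and> (\<exists>ys. length ys = 0 \<and> xs @ ys \<in> X)} = X"
    using definable_length by fastforce
  with 0 show ?case
    by simp
next
  case (Suc n)
  let ?Y = "{xs. length xs = Suc m \<and> (\<exists>ys. length ys = n \<and> xs @ ys \<in> X)}"
  have "definable M (Suc m) ?Y"
    using Suc.IH[of "Suc m"] Suc.prems by simp
  moreover have "(\<exists>ys. length ys = Suc n \<and> P ys) \<longleftrightarrow> (\<exists>a ys. length ys = n \<and> P (a # ys))"
    for P :: "'c list \<Rightarrow> bool"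
    by (metis length_Suc_conv)
  then have "{xs. length xs = m \<and> (\<exists>ys. length ys = Suc n \<and> xs @ ys \<in> X)} =
      {xs. length xs = m \<and> (\<exists>a. xs @ [a] \<in> ?Y)}"
    by auto
  ultimately show ?case
    using definable_projection1[of M m ?Y] by simp
qed

text \<open>Covers both permuting coordinates and adding dummy ones. Distinctness of the indices
  makes the renaming injective.\<close>

lemma definable_reindex:
  assumes "definable M n X" and "length is = n" and "distinct is" and "set is \<subseteq> {..<m}"
  shows "definable M m {xs. length xs = m \<and> map ((!) xs) is \<in> X}"
proof -
  obtain \<phi> e where \<phi>: "wf_fm M \<phi>"
    and X: "X = {xs. length xs = n \<and> sat M (\<lambda>i. if i < n then xs ! i else e i) \<phi>}"
    using assms(1) by (auto simp: definable_def)
  \<comment> \<open>Parameters are moved to \<open>m + i\<close>, clear of all \<open>m\<close>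
    coordinates, and are read back through \<open>e (i - m)\<close>.\<close>
  define \<sigma> where "\<sigma> i = (if i < n then is ! i else m + i)" for i
  have is_less: "is ! i < m" if "i < n" for i
    using that assms(2,4) nth_mem by fastforce
  have "inj \<sigma>"
  proof (rule injI)
    fix i j
    assume "\<sigma> i = \<sigma> j"
    then show "i = j"
      using is_less[of i] is_less[of j] assms(2,3)
      by (auto simp: \<sigma>_def nth_eq_iff_index_eq split: if_splits)
  qed
  moreover have "(\<lambda>i. if i < m then xs ! i else e (i - m)) \<circ> \<sigma> =
      (\<lambda>i. if i < n then map ((!) xs) is ! i else e i)" for xs
    using assms(2) is_less by (auto simp: fun_eq_iff \<sigma>_def)
  ultimately have "{xs. length xs = m \<and> map ((!) xs) is \<in> X} =
      {xs. length xs = m \<and> sat M (\<lambda>i. if i < m then xs ! i else e (i - m)) (rename_fm \<sigma> \<phi>)}"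
    using assms(2) by (auto simp: X sat_rename)
  moreover have "wf_fm M (rename_fm \<sigma> \<phi>)"
    using \<phi> by simp
  ultimately show ?thesis
    unfolding definable_def by (intro exI[of _ "rename_fm \<sigma> \<phi>"] exI[of _ "\<lambda>i. e (i - m)"]) simp
qed

text \<open>A relation between points of the \<open>n\<close>-th power is written as a predicate on sequences of
  points, of which only the first \<open>k\<close> entries matter; the remaining ones are empty lists.\<close>

definition block :: "nat \<Rightarrow> 'a list \<Rightarrow> nat \<Rightarrow> 'a list" where
  "block n xs i = take n (drop (i * n) xs)"

definition definable_rel ::
    "('f, 'r, 'a::linorder) ordered_structure \<Rightarrow> nat \<Rightarrow> nat \<Rightarrow> ((nat \<Rightarrow> 'a list) \<Rightarrow> bool) \<Rightarrow> bool" where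
  "definable_rel M n k R \<longleftrightarrow> definable M (k * n) {xs. length xs = k * n \<and> R (block n xs)}"

lemma length_block: "i * n + n \<le> length xs \<Longrightarrow> length (block n xs i) = n"
  by (simp add: block_def)

lemma nth_block: "i * n + n \<le> length xs \<Longrightarrow> t < n \<Longrightarrow> block n xs i ! t = xs ! (i * n + t)"
  by (simp add: block_def)

text \<open>Before the extension the entry at \<open>k\<close> is the empty list, and the entries
  beyond \<open>k\<close> are empty before and after. Adjoining a point thus becomes a function
  update, the form in which fibres and projections are used below.\<close>

lemma block_append:
  assumes "length xs = k * n" and "length c = n"
  shows "block n (xs @ c) = (block n xs)(k := c)"
proof
  fix i
  consider "i < k" | "i = k" | "k < i"
    by linarith
  then show "block n (xs @ c) i = ((block n xs)(k := c)) i"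
  proof cases
    case 1
    then have "Suc i * n \<le> k * n"
      by (intro mult_le_mono1) simp
    with 1 assms show ?thesis
      by (simp add: block_def)
  next
    case 3
    then have "Suc k * n \<le> i * n"
      by (intro mult_le_mono1) simp
    with 3 assms show ?thesis
      by (simp add: block_def)
  qed (use assms in \<open>simp add: block_def\<close>)
qed

section \<open>Operations on definable relations\<close>

lemma definable_rel_conj:
  assumes "definable_rel M n k R" and "definable_rel M n k S"
  shows "definable_rel M n k (\<lambda>v. R v \<and> S v)"
proof -
  have "{xs. length xs = k * n \<and> R (block n xs) \<and> S (block n xs)} =
      {xs. length xs = k * n \<and> R (block n xs)} \<inter> {xs. length xs = k * n \<and> S (block n xs)}"
    by blast
  then show ?thesis
    using definable_Int assms unfolding definable_rel_def by simp
qed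

text \<open>Only the last place can be filled, so places are rearranged beforehand. The separate
  premise \<open>m = Suc k\<close> allows the number of places to be a numeral.\<close>

lemma definable_rel_fix:
  assumes "definable_rel M n m R" and "length c = n" and "m = Suc k"
  shows "definable_rel M n k (\<lambda>v. R (v(k := c)))"
proof -
  have "definable M (k * n + n) {xs. length xs = Suc k * n \<and> R (block n xs)}"
    using assms(1,3) unfolding definable_rel_def by (simp add: add.commute)
  from definable_fibre[OF this assms(2)] show ?thesis
    unfolding definable_rel_def using assms(2) by (simp add: block_append[where k = k] cong: conj_cong)
qed

lemma definable_rel_ex:
  assumes "definable_rel M n m R" and "m = Suc k"
  shows "definable_rel M n k (\<lambda>v. \<exists>c. length c = n \<and> R (v(k := c)))"
proof -
  have "definable M (k * n + n) {xs. length xs = Suc k * n \<and> R (block n xs)}"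
    using assms unfolding definable_rel_def by (simp add: add.commute)
  from definable_projection[OF this] show ?thesis
    unfolding definable_rel_def by (simp add: block_append[where k = k] cong: conj_cong)
qed

text \<open>Lifts a rearrangement of points to one of coordinates. Outside the first
  \<open>k\<close> places \<open>R\<close> is given empty lists, in accordance with what
  \<open>block\<close> yields there.\<close>

lemma definable_rel_reindex:
  assumes R: "definable_rel M n k R" and js: "length js = k" "distinct js" "set js \<subseteq> {..<m}"
  shows "definable_rel M n m (\<lambda>v. R (\<lambda>i. if i < k then v (js ! i) else []))"
proof -
  \<comment> \<open>Coordinate \<open>i mod n\<close> of point \<open>i div n\<close> is sent to the
    same coordinate of the point numbered \<open>js ! (i div n)\<close>.\<close>
  define f where "f i = js ! (i div n) * n + i mod n" for i
  have js_less: "js ! j < m" if "j < k" for j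
    using that js(1,3) nth_mem by fastforce
  have div_less: "i div n < k" if "i < k * n" for i
    using that by (simp add: less_mult_imp_div_less)
  have f_less: "f i < m * n" if "i < k * n" for i
  proof -
    have "i mod n < n"
      using that by (cases n) auto
    then have "f i < Suc (js ! (i div n)) * n"
      by (simp add: f_def)
    also have "\<dots> \<le> m * n"
      using js_less[OF div_less[OF that]] by (intro mult_le_mono1) simp
    finally show ?thesis .
  qed
  have "inj_on f {..<k * n}"
  proof (rule inj_onI)
    fix i i'
    assume i: "i \<in> {..<k * n}" "i' \<in> {..<k * n}" and eq: "f i = f i'"
    then have "n > 0"
      by (cases n) auto
    then have f: "f j div n = js ! (j div n)" "f j mod n = j mod n" for j
      by (simp_all add: f_def)
    have "js ! (i div n) = js ! (i' div n)" and mod: "i mod n = i' mod n"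
      using arg_cong[OF eq, of "\<lambda>x. x div n"] arg_cong[OF eq, of "\<lambda>x. x mod n"]
      by (simp_all only: f)
    moreover have "i div n < k" "i' div n < k"
      using i div_less by simp_all
    ultimately have "i div n = i' div n"
      using js(1,2) nth_eq_iff_index_eq by blast
    with mod show "i = i'"
      by (metis div_mult_mod_eq)
  qed
  then have "distinct (map f [0..<k * n])"
    by (simp add: distinct_map atLeast0LessThan)
  moreover have "set (map f [0..<k * n]) \<subseteq> {..<m * n}"
    using f_less by auto
  ultimately have "definable M (m * n) {xs. length xs = m * n \<and>
      map ((!) xs) (map f [0..<k * n]) \<in> {xs. length xs = k * n \<and> R (block n xs)}}"
    using R unfolding definable_rel_def by (intro definable_reindex[of M "k * n"]) simp_all
  moreover have "block n (map ((!) xs) (map f [0..<k * n])) =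
      (\<lambda>i. if i < k then block n xs (js ! i) else [])" if xs: "length xs = m * n" for xs :: "'c list"
  proof
    fix i
    show "block n (map ((!) xs) (map f [0..<k * n])) i = (if i < k then block n xs (js ! i) else [])"
    proof (cases "i < k")
      case True
      then have le: "i * n + n \<le> k * n"
        using mult_le_mono1[of "Suc i" k n] by simp
      have le': "js ! i * n + n \<le> m * n"
        using mult_le_mono1[of "Suc (js ! i)" m n] js_less[OF True] by simp
      have "block n (map ((!) xs) (map f [0..<k * n])) i = block n xs (js ! i)"
      proof (rule nth_equalityI)
        fix t
        assume "t < length (block n (map ((!) xs) (map f [0..<k * n])) i)"
        then have t: "t < n"
          by (simp add: block_def)
        have "block n (map ((!) xs) (map f [0..<k * n])) i ! t = xs ! f (i * n + t)"
          using le t by (simp add: nth_block)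
        also have "f (i * n + t) = js ! i * n + t"
          using t by (simp add: f_def)
        also have "xs ! (js ! i * n + t) = block n xs (js ! i) ! t"
          using le' t xs by (simp add: nth_block)
        finally show "block n (map ((!) xs) (map f [0..<k * n])) i ! t = block n xs (js ! i) ! t" .
      qed (use le le' xs in \<open>simp add: length_block\<close>)
      with True show ?thesis
        by simp
    next
      case False
      then show ?thesis
        by (simp add: block_def)
    qed
  qed
  ultimately show ?thesis
    unfolding definable_rel_def by (simp cong: conj_cong)
qed

lemma definable_rel_unary_iff:
  assumes "\<And>x. x \<in> A \<Longrightarrow> length x = n"
  shows "definable_rel M n 1 (\<lambda>v. v 0 \<in> A) \<longleftrightarrow> definable M n A"
proof -
  have "length xs = 1 * n \<and> block n xs 0 \<in> A \<longleftrightarrow> xs \<in> A" for xs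
    using assms[of xs] by (auto simp: block_def)
  then show ?thesis
    by (simp add: definable_rel_def)
qed

lemma definable_rel_mem:
  "definable M n A \<Longrightarrow> definable_rel M n 1 (\<lambda>v. v 0 \<in> A)"
  using definable_rel_unary_iff[of A n M] definable_length[of M n A] by simp

subsection \<open>Finite index and cyclic extensions\<close>

text \<open>Rephrases finite index by a finite set of representatives, since
  \<open>cyclic_ext_eq\<close> delivers groups as products \<open>H <#> B\<close> with
  \<open>B\<close> finite.\<close>

lemma (in group) finite_rcosets_iff:
  assumes "subgroup H G"
  shows "finite (rcosets H) \<longleftrightarrow> (\<exists>B. finite B \<and> B \<subseteq> carrier G \<and> carrier G = H <#> B)"
proof
  assume fin: "finite (rcosets H)"
  have "rcosets H \<subseteq> (\<lambda>a. H #> a) ` carrier G"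
    unfolding RCOSETS_def by blast
  from finite_subset_image[OF fin this] obtain B
    where B: "finite B" "B \<subseteq> carrier G" "rcosets H = (\<lambda>a. H #> a) ` B"
    by metis
  have "H <#> B = \<Union>(rcosets H)"
    unfolding B(3) set_mult_def r_coset_def by blast
  then show "\<exists>B. finite B \<and> B \<subseteq> carrier G \<and> carrier G = H <#> B"
    using B(1,2) rcosets_part_G[OF assms] by (intro exI[of _ B]) simp
next
  assume "\<exists>B. finite B \<and> B \<subseteq> carrier G \<and> carrier G = H <#> B"
  then obtain B where B: "finite B" "B \<subseteq> carrier G" "carrier G = H <#> B"
    by blast
  have "rcosets H \<subseteq> (\<lambda>b. H #> b) ` B"
  proof
    fix C
    assume "C \<in> rcosets H"
    then obtain a where "a \<in> carrier G" and C: "C = H #> a"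
      unfolding RCOSETS_def by blast
    then have "a \<in> H <#> B"
      using B(3) by simp
    then obtain b where "b \<in> B" "a \<in> H #> b"
      unfolding set_mult_def r_coset_def by blast
    then show "C \<in> (\<lambda>b. H #> b) ` B"
      using repr_independence[OF _ _ assms] B(2) C by blast
  qed
  then show "finite (rcosets H)"
    by (rule finite_surj[OF B(1)])
qed

lemma (in group) finite_set_mult:
  "finite A \<Longrightarrow> finite B \<Longrightarrow> finite (A <#> B)"
  unfolding set_mult_def by simp

text \<open>Representatives multiply: if \<open>A\<close> represents the cosets of \<open>H\<close>,
  then \<open>B <#> A\<close> represents those of \<open>K\<close>.\<close>

lemma (in group) finite_rcosets_trans:
  assumes "subgroup H G" and "subgroup K G" and "finite (rcosets H)"
    and "finite B" and "B \<subseteq> carrier G" and "H = K <#> B"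
  shows "finite (rcosets K)"
proof -
  obtain A where A: "finite A" "A \<subseteq> carrier G" "carrier G = H <#> A"
    using finite_rcosets_iff assms(1,3) by blast
  have "carrier G = K <#> (B <#> A)"
    using A(3) set_mult_assoc[OF subgroup.subset[OF assms(2)] assms(5) A(2)] assms(6) by simp
  moreover have "finite (B <#> A)" "B <#> A \<subseteq> carrier G"
    using A assms(4,5) finite_set_mult set_mult_closed by auto
  ultimately show ?thesis
    using finite_rcosets_iff assms(2) by blast
qed

text \<open>Pigeonhole principle: two different powers of \<open>g\<close> lie in the same coset,
  and the difference of their exponents serves as \<open>k\<close>.\<close>

lemma (in group) finite_rcosets_pow_mem:
  assumes "subgroup H G" and "finite (rcosets H)" and "g \<in> carrier G"
  obtains k :: nat where "k > 0" and "g [^] k \<in> H"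
proof -
  have "range (\<lambda>i::nat. H #> g [^] i) \<subseteq> rcosets H"
    using assms(3) unfolding RCOSETS_def by auto
  then have "finite (range (\<lambda>i::nat. H #> g [^] i))"
    using assms(2) finite_subset by blast
  then have "\<not> inj (\<lambda>i::nat. H #> g [^] i)"
    using finite_imageD by blast
  then obtain i j :: nat where "i < j" and eq: "H #> g [^] j = H #> g [^] i"
    unfolding inj_def by (metis linorder_neqE_nat)
  have "g [^] j \<in> H #> g [^] i"
    using eq rcos_self[OF _ assms(1), of "g [^] j"] assms(3) by auto
  then obtain h where h: "h \<in> H" "g [^] j = h \<otimes> g [^] i"
    unfolding r_coset_def by blast
  moreover have "g [^] j = g [^] (j - i) \<otimes> g [^] i"
    using \<open>i < j\<close> assms(3) by (simp add: nat_pow_mult)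
  ultimately have "h = g [^] (j - i)"
    using assms(1,3) by (metis nat_pow_closed right_cancel subgroup.mem_carrier)
  then show thesis
    using that[of "j - i"] \<open>i < j\<close> h(1) by simp
qed

lemma (in group) subgroup_nat_pow_closed:
  fixes k :: nat
  assumes "subgroup H G" and "h \<in> H"
  shows "h [^] k \<in> H"
  using subgroup_int_pow_closed[OF assms, of "int k"] by (simp add: int_pow_int)

text \<open>In an abelian group, with \<open>H\<close> a subgroup, this is the subgroup generated by
  \<open>H\<close> and \<open>g\<close>.\<close>

definition cyclic_ext :: "('a, 'b) monoid_scheme \<Rightarrow> 'a set \<Rightarrow> 'a \<Rightarrow> 'a set" where
  "cyclic_ext G H g = H <#>\<^bsub>G\<^esub> range (\<lambda>i::int. g [^]\<^bsub>G\<^esub> i)"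

lemma (in comm_group) subgroup_cyclic_ext:
  assumes "subgroup H G" and "g \<in> carrier G"
  shows "subgroup (cyclic_ext G H g) G"
proof -
  have "generate G {g} = range (\<lambda>i::int. g [^] i)"
    using generate_pow[OF assms(2)] by auto
  then show ?thesis
    unfolding cyclic_ext_def
    using mult_subgroups[OF assms(1)] generate_is_subgroup[of "{g}"] assms(2) by simp
qed

lemma (in group) mem_cyclic_ext:
  assumes "subgroup H G" and "g \<in> carrier G"
  shows "g \<in> cyclic_ext G H g"
proof -
  have "g = \<one> \<otimes> g [^] (1::int)"
    using assms(2) by (simp add: int_pow_1)
  then show ?thesis
    unfolding cyclic_ext_def set_mult_def using subgroup.one_closed[OF assms(1)] by blast
qed

lemma (in group) cyclic_ext_least:
  assumes "subgroup K G" and "H \<subseteq> K" and "g \<in> K"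
  shows "cyclic_ext G H g \<subseteq> K"
proof -
  have "g [^] i \<in> K" for i :: int
    using assms subgroup_int_pow_closed by blast
  then show ?thesis
    unfolding cyclic_ext_def set_mult_def
    using assms(2) subgroup.m_closed[OF assms(1)] by blast
qed

text \<open>Division with remainder: the multiple of \<open>k\<close> in an exponent is absorbed by
  \<open>H\<close>. Only finitely many cosets are left, which serves both definability and finite
  index.\<close>

lemma (in group) cyclic_ext_eq:
  fixes k :: nat
  assumes H: "subgroup H G" and g: "g \<in> carrier G" and "k > 0" and gk: "g [^] k \<in> H"
  shows "cyclic_ext G H g = H <#> (\<lambda>i. g [^] i) ` {..<k}"
proof
  show "cyclic_ext G H g \<subseteq> H <#> (\<lambda>i. g [^] i) ` {..<k}"
  proof
    fix x
    assume "x \<in> cyclic_ext G H g"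
    then obtain h and i :: int where h: "h \<in> H" and x: "x = h \<otimes> g [^] i"
      unfolding cyclic_ext_def set_mult_def by blast
    \<comment> \<open>The exponent \<open>i\<close> may be negative; its remainder is a natural
      number below \<open>k\<close>.\<close>
    define r where "r = nat (i mod int k)"
    have r: "r < k" "int r = i mod int k"
      using \<open>k > 0\<close> by (auto simp: r_def nat_less_iff)
    have "g [^] i = g [^] (int k * (i div int k) + int r)"
      by (simp add: r(2))
    also have "\<dots> = (g [^] k) [^] (i div int k) \<otimes> g [^] r"
      using g by (simp add: int_pow_mult int_pow_int flip: int_pow_pow)
    finally have "x = (h \<otimes> (g [^] k) [^] (i div int k)) \<otimes> g [^] r"
      using x g h H by (simp add: m_assoc subgroup.mem_carrier)
    moreover have "h \<otimes> (g [^] k) [^] (i div int k) \<in> H"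
      using h gk H by (simp add: subgroup.m_closed subgroup_int_pow_closed)
    ultimately show "x \<in> H <#> (\<lambda>i. g [^] i) ` {..<k}"
      unfolding set_mult_def using r(1) by blast
  qed
  show "H <#> (\<lambda>i. g [^] i) ` {..<k} \<subseteq> cyclic_ext G H g"
  proof -
    have "(\<lambda>i. g [^] i) ` {..<k} \<subseteq> range (\<lambda>i::int. g [^] i)"
      by (metis image_subsetI int_pow_int rangeI)
    then show ?thesis
      unfolding cyclic_ext_def by (rule mono_set_mult[OF order_refl])
  qed
qed

text \<open>The powers of the coset of \<open>g\<close> are the cosets of the powers of
  \<open>g\<close>, and \<open>cyclic_ext G H g\<close> is their union. They exhaust the quotient
  exactly when this union is the whole group.\<close>

lemma (in comm_group) cyclic_FactGroup_iff:
  assumes "subgroup H G"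
  shows "cyclic_group (G Mod H) \<longleftrightarrow> (\<exists>g\<in>carrier G. cyclic_ext G H g = carrier G)"
proof -
  interpret H: normal H G
    using assms by (simp add: subgroup_imp_normal)
  interpret Q: group "G Mod H"
    by (rule H.factorgroup_is_group)
  have "carrier (G Mod H) = range (\<lambda>i::int. (H #> g) [^]\<^bsub>G Mod H\<^esub> i) \<longleftrightarrow> cyclic_ext G H g = carrier G"
    if g: "g \<in> carrier G" for g
  proof -
    have pow: "(H #> g) [^]\<^bsub>G Mod H\<^esub> i = H #> g [^] i" for i :: int
      using H.FactGroup_int_pow g by simp
    have car: "carrier (G Mod H) = rcosets H"
      by (simp add: FactGroup_def)
    have U: "cyclic_ext G H g = (\<Union>i::int. H #> g [^] i)"
      unfolding cyclic_ext_def set_mult_def r_coset_def by blast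
    show ?thesis
    proof
      assume "carrier (G Mod H) = range (\<lambda>i::int. (H #> g) [^]\<^bsub>G Mod H\<^esub> i)"
      then have "rcosets H = range (\<lambda>i::int. H #> g [^] i)"
        by (simp only: pow car)
      then show "cyclic_ext G H g = carrier G"
        unfolding U using rcosets_part_G[OF assms] by simp
    next
      assume ext: "cyclic_ext G H g = carrier G"
      have "rcosets H \<subseteq> range (\<lambda>i::int. H #> g [^] i)"
      proof
        fix C
        assume "C \<in> rcosets H"
        then obtain a where a: "a \<in> carrier G" "C = H #> a"
          unfolding RCOSETS_def by blast
        then obtain i :: int where "a \<in> H #> g [^] i"
          using ext unfolding U by blast
        then show "C \<in> range (\<lambda>i::int. H #> g [^] i)"
          using repr_independence[OF _ _ assms] g a(2) by auto
      qed
      moreover have "range (\<lambda>i::int. H #> g [^] i) \<subseteq> rcosets H"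
        using g unfolding RCOSETS_def by auto
      ultimately show "carrier (G Mod H) = range (\<lambda>i::int. (H #> g) [^]\<^bsub>G Mod H\<^esub> i)"
        by (simp only: pow car)
    qed
  qed
  moreover have "carrier (G Mod H) = (\<lambda>g. H #> g) ` carrier G"
    by (auto simp: FactGroup_def RCOSETS_def)
  ultimately show ?thesis
    unfolding Q.cyclic_group by auto
qed

subsection \<open>Definable subgroups\<close>

locale definable_comm_group = comm_group G
  for G :: "'a::linorder list monoid" (structure)
    and M :: "('f, 'r, 'a) ordered_structure" and n :: nat +
  assumes definable_group: "definable_group M n G"
begin

section \<open>Definability of products, cosets and powers\<close>

lemma definable_carrier: "definable M n (carrier G)"
  using definable_group unfolding definable_group_def by blast

lemma length_carrier: "x \<in> carrier G \<Longrightarrow> length x = n"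
  by (rule definable_length[OF definable_carrier])

lemma definable_rel_mult:
  "definable_rel M n 3 (\<lambda>v. v 0 \<in> carrier G \<and> v 1 \<in> carrier G \<and> v 2 = v 0 \<otimes> v 1)"
proof -
  have "{x @ y @ (x \<otimes> y) | x y. x \<in> carrier G \<and> y \<in> carrier G} =
      {xs. length xs = 3 * n \<and> block n xs 0 \<in> carrier G \<and> block n xs 1 \<in> carrier G \<and>
        block n xs 2 = block n xs 0 \<otimes> block n xs 1}" (is "?L = ?R")
  proof (intro equalityI subsetI)
    fix xs
    assume "xs \<in> ?L"
    then obtain x y where xy: "x \<in> carrier G" "y \<in> carrier G" and xs: "xs = x @ y @ (x \<otimes> y)"
      by blast
    then have "length x = n" "length y = n" "length (x \<otimes> y) = n"
      by (simp_all add: length_carrier)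
    with xy show "xs \<in> ?R"
      by (simp add: xs block_def)
  next
    fix xs
    assume xs: "xs \<in> ?R"
    then have "length xs = 3 * n"
      by blast
    \<comment> \<open>The length \<open>3 * n\<close> makes the final piece a full block, so these
      are the three points of the graph.\<close>
    have "xs = take n xs @ take n (drop n xs) @ drop (n + n) xs"
      by (metis append_take_drop_id drop_drop)
    moreover have "block n xs 0 = take n xs" "block n xs 1 = take n (drop n xs)"
      "block n xs 2 = drop (n + n) xs"
      using \<open>length xs = 3 * n\<close> by (simp_all add: block_def mult_2)
    moreover have "block n xs 0 \<in> carrier G" "block n xs 1 \<in> carrier G"
      "block n xs 2 = block n xs 0 \<otimes> block n xs 1"
      using xs by blast+
    ultimately show "xs \<in> ?L"
      by (intro CollectI exI[of _ "block n xs 0"] exI[of _ "block n xs 1"] conjI) (simp_all only:)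
  qed
  then show ?thesis
    using definable_group unfolding definable_rel_def definable_group_def by simp
qed

lemma definable_r_coset:
  assumes A: "definable M n A" "A \<subseteq> carrier G" and g: "g \<in> carrier G"
  shows "definable M n (A #> g)"
proof -
  \<comment> \<open>The product stands at place 0 and the factors at 1 and 2, so that first
    \<open>g\<close> can be fixed at the end and then the element of \<open>A\<close> projected
    away.\<close>
  have "definable_rel M n 3 (\<lambda>v. v 1 \<in> carrier G \<and> v 2 \<in> carrier G \<and> v 0 = v 1 \<otimes> v 2)"
    using definable_rel_reindex[OF definable_rel_mult, of "[1, 2, 0]" 3] by simp
  moreover have "definable_rel M n 3 (\<lambda>v. v 1 \<in> A)"
    using definable_rel_reindex[OF definable_rel_mem[OF A(1)], of "[1]" 3] by simp
  ultimately have "definable_rel M n 3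
      (\<lambda>v. (v 1 \<in> carrier G \<and> v 2 \<in> carrier G \<and> v 0 = v 1 \<otimes> v 2) \<and> v 1 \<in> A)"
    by (rule definable_rel_conj)
  from definable_rel_fix[OF this length_carrier[OF g], of 2]
  have "definable_rel M n 2 (\<lambda>v. (v 1 \<in> carrier G \<and> v 0 = v 1 \<otimes> g) \<and> v 1 \<in> A)"
    using g by simp
  from definable_rel_ex[OF this, of 1]
  have "definable_rel M n 1
      (\<lambda>v. \<exists>x. length x = n \<and> (x \<in> carrier G \<and> v 0 = x \<otimes> g) \<and> x \<in> A)"
    by simp
  moreover have "(\<exists>x. length x = n \<and> (x \<in> carrier G \<and> z = x \<otimes> g) \<and> x \<in> A) \<longleftrightarrow> z \<in> A #> g" for z
    using A(2) length_carrier unfolding r_coset_def by blast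
  ultimately have "definable_rel M n 1 (\<lambda>v. v 0 \<in> A #> g)"
    by simp
  moreover have "length z = n" if "z \<in> A #> g" for z
    using that r_coset_subset_G[OF A(2) g] length_carrier by blast
  ultimately show ?thesis
    using definable_rel_unary_iff by blast
qed

text \<open>By induction on \<open>k\<close>, with \<open>x [^] k\<close> as the quantified
  intermediate point. The base stands last, ready to be projected away for the image.\<close>

lemma definable_rel_pow:
  fixes k :: nat
  assumes A: "definable M n A" "A \<subseteq> carrier G"
  shows "definable_rel M n 2 (\<lambda>v. v 1 \<in> A \<and> v 0 = v 1 [^] k)"
proof (induction k)
  case 0
  \<comment> \<open>The equation \<open>y = \<one>\<close> is expressed as \<open>y = \<one> \<otimes> \<one>\<close>.\<close>
  have "definable_rel M n 4 (\<lambda>v. v 2 \<in> carrier G \<and> v 3 \<in> carrier G \<and> v 0 = v 2 \<otimes> v 3)"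
    using definable_rel_reindex[OF definable_rel_mult, of "[2, 3, 0]" 4] by simp
  moreover have "definable_rel M n 4 (\<lambda>v. v 1 \<in> A)"
    using definable_rel_reindex[OF definable_rel_mem[OF A(1)], of "[1]" 4] by simp
  ultimately have "definable_rel M n 4
      (\<lambda>v. (v 2 \<in> carrier G \<and> v 3 \<in> carrier G \<and> v 0 = v 2 \<otimes> v 3) \<and> v 1 \<in> A)"
    by (rule definable_rel_conj)
  from definable_rel_fix[OF this, of \<one> 3]
  have "definable_rel M n 3 (\<lambda>v. (v 2 \<in> carrier G \<and> v 0 = v 2 \<otimes> \<one>) \<and> v 1 \<in> A)"
    by (simp add: length_carrier)
  from definable_rel_fix[OF this, of \<one> 2]
  have "definable_rel M n 2 (\<lambda>v. v 0 = \<one> \<and> v 1 \<in> A)"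
    by (simp add: length_carrier)
  then show ?case
    by (simp add: conj_commute)
next
  case (Suc k)
  have "definable_rel M n 3 (\<lambda>v. v 2 \<in> carrier G \<and> v 1 \<in> carrier G \<and> v 0 = v 2 \<otimes> v 1)"
    using definable_rel_reindex[OF definable_rel_mult, of "[2, 1, 0]" 3] by simp
  moreover have "definable_rel M n 3 (\<lambda>v. v 1 \<in> A \<and> v 2 = v 1 [^] k)"
    using definable_rel_reindex[OF Suc.IH, of "[2, 1]" 3] by simp
  ultimately have "definable_rel M n 3 (\<lambda>v.
      (v 2 \<in> carrier G \<and> v 1 \<in> carrier G \<and> v 0 = v 2 \<otimes> v 1) \<and> v 1 \<in> A \<and> v 2 = v 1 [^] k)"
    by (rule definable_rel_conj)
  from definable_rel_ex[OF this, of 2]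
  have "definable_rel M n 2 (\<lambda>v. \<exists>z. length z = n \<and>
      (z \<in> carrier G \<and> v 1 \<in> carrier G \<and> v 0 = z \<otimes> v 1) \<and> v 1 \<in> A \<and> z = v 1 [^] k)"
    by simp
  moreover have "(\<exists>z. length z = n \<and> (z \<in> carrier G \<and> x \<in> carrier G \<and> y = z \<otimes> x) \<and>
      x \<in> A \<and> z = x [^] k) \<longleftrightarrow> x \<in> A \<and> y = x [^] Suc k" for x y
  proof (cases "x \<in> A")
    case True
    then have x: "x \<in> carrier G"
      using A(2) by blast
    with True show ?thesis
      using length_carrier[OF nat_pow_closed[OF x, of k]] by simp
  qed simp
  ultimately show ?case
    by (simp only:)
qed

lemma definable_pow_image:
  fixes k :: nat
  assumes A: "definable M n A" "A \<subseteq> carrier G"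
  shows "definable M n ((\<lambda>x. x [^] k) ` A)"
proof -
  from definable_rel_ex[OF definable_rel_pow[OF A], of 1 k]
  have "definable_rel M n 1 (\<lambda>v. \<exists>x. length x = n \<and> x \<in> A \<and> v 0 = x [^] k)"
    by simp
  moreover have "(\<exists>x. length x = n \<and> x \<in> A \<and> y = x [^] k) \<longleftrightarrow> y \<in> (\<lambda>x. x [^] k) ` A" for y
    using A(2) length_carrier by blast
  ultimately have "definable_rel M n 1 (\<lambda>v. v 0 \<in> (\<lambda>x. x [^] k) ` A)"
    by simp
  moreover have "length y = n" if "y \<in> (\<lambda>x. x [^] k) ` A" for y
    using that A(2) nat_pow_closed length_carrier by blast
  ultimately show ?thesis
    using definable_rel_unary_iff by blast
qed

lemma definable_subgroup_cyclic_ext: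
  fixes k :: nat
  assumes H: "definable_subgroup M n G H" and g: "g \<in> carrier G" and "k > 0" and "g [^] k \<in> H"
  shows "definable_subgroup M n G (cyclic_ext G H g)"
proof -
  have sub: "subgroup H G" and def_H: "definable M n H"
    using H by (simp_all add: definable_subgroup_def)
  have "cyclic_ext G H g = H <#> (\<lambda>i. g [^] i) ` {..<k}"
    using cyclic_ext_eq[OF sub] assms(2-4) by blast
  also have "\<dots> = (\<Union>i<k. H #> g [^] i)"
    unfolding set_mult_def r_coset_def by blast
  finally have "cyclic_ext G H g = (\<Union>i<k. H #> g [^] i)" .
  moreover have "definable M n (\<Union>i<k. H #> g [^] i)"
    using definable_r_coset[OF def_H subgroup.subset[OF sub]] g by (intro definable_UN) simp_all
  ultimately show ?thesis
    using subgroup_cyclic_ext[OF sub g] by (simp add: definable_subgroup_def)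
qed

text \<open>Definable subgroups of \<open>H\<close> are the definable subgroups of \<open>G\<close>
  inside \<open>H\<close>, and any definable subgroup of \<open>G\<close> can be intersected with
  \<open>H\<close>. Hence \<open>H\<close> may be tested against subgroups of
  \<open>G\<close>.\<close>

lemma monogenic_subgroup_iff:
  assumes H: "definable_subgroup M n G H"
  shows "monogenic M n (G\<lparr>carrier := H\<rparr>) \<longleftrightarrow>
    (\<exists>h\<in>H. \<forall>K. definable_subgroup M n G K \<and> h \<in> K \<longrightarrow> H \<subseteq> K)" (is "_ \<longleftrightarrow> ?R")
proof -
  have sub: "subgroup H G" and def_H: "definable M n H"
    using H by (simp_all add: definable_subgroup_def)
  have iff: "definable_subgroup M n (G\<lparr>carrier := H\<rparr>) K \<longleftrightarrow> definable_subgroup M n G K \<and> K \<subseteq> H" for K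
    using subgroup_incl[OF _ sub] incl_subgroup[OF sub] subgroup.subset[of K "G\<lparr>carrier := H\<rparr>"]
    unfolding definable_subgroup_def by auto
  have Int: "definable_subgroup M n G (K \<inter> H)" if "definable_subgroup M n G K" for K
    using that H subgroups_Inter_pair definable_Int unfolding definable_subgroup_def by blast
  have "is_definable_hull M n (G\<lparr>carrier := H\<rparr>) {h} H \<longleftrightarrow>
      h \<in> H \<and> (\<forall>K. definable_subgroup M n G K \<and> h \<in> K \<longrightarrow> H \<subseteq> K)" for h
    unfolding is_definable_hull_def iff using H Int by blast
  then show ?thesis
    by (auto simp: monogenic_def)
qed

lemma monogenic_iff:
  "monogenic M n G \<longleftrightarrow>
    (\<exists>g\<in>carrier G. \<forall>K. definable_subgroup M n G K \<and> g \<in> K \<longrightarrow> carrier G \<subseteq> K)"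
  using definable_carrier subgroup_self
  by (simp add: monogenic_def is_definable_hull_def definable_subgroup_def cong: bex_cong)

section \<open>Divisibility of the component and the two implications\<close>

lemma monogenic_component_divisible:
  fixes k :: nat
  assumes comp: "is_definable_component M n G G0" and h: "h \<in> G0"
    and gen: "\<And>K. definable_subgroup M n G K \<Longrightarrow> h \<in> K \<Longrightarrow> G0 \<subseteq> K" and "k > 0"
  shows "(\<lambda>x. x [^] k) ` G0 = G0"
proof -
  have sub: "subgroup G0 G" and def_G0: "definable M n G0" and fin: "finite (rcosets G0)"
    and least: "\<And>K. definable_subgroup M n G K \<Longrightarrow> finite (rcosets K) \<Longrightarrow> G0 \<subseteq> K"
    using comp by (auto simp: is_definable_component_def definable_subgroup_def)
  let ?D = "(\<lambda>x. x [^] k) ` G0"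
  have D_sub: "?D \<subseteq> G0"
    using subgroup_nat_pow_closed[OF sub] by blast
  have h_car: "h \<in> carrier G"
    using h subgroup.mem_carrier[OF sub] by blast
  \<comment> \<open>By commutativity, taking \<open>k\<close>-th powers is a homomorphism.\<close>
  have "subgroup ?D G"
  proof (rule subgroupI)
    show "?D \<subseteq> carrier G"
      using D_sub subgroup.subset[OF sub] by blast
    show "?D \<noteq> {}"
      using h by blast
    show "inv a \<in> ?D" if "a \<in> ?D" for a
      using that subgroup.m_inv_closed[OF sub] subgroup.mem_carrier[OF sub]
      by (auto simp flip: nat_pow_inv)
    show "a \<otimes> b \<in> ?D" if "a \<in> ?D" "b \<in> ?D" for a b
      using that subgroup.m_closed[OF sub] subgroup.mem_carrier[OF sub]
      by (auto simp flip: nat_pow_distrib)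
  qed
  then have D: "definable_subgroup M n G ?D"
    using definable_pow_image[OF def_G0 subgroup.subset[OF sub]] by (simp add: definable_subgroup_def)
  \<comment> \<open>Adjoining \<open>h\<close> to \<open>?D\<close> therefore adds only finitely
    many cosets, and the result is definable.\<close>
  have hk: "h [^] k \<in> ?D"
    using h by blast
  have "definable_subgroup M n G (cyclic_ext G ?D h)"
    by (rule definable_subgroup_cyclic_ext[OF D h_car \<open>k > 0\<close> hk])
  then have "G0 \<subseteq> cyclic_ext G ?D h"
    using gen mem_cyclic_ext[OF \<open>subgroup ?D G\<close> h_car] by blast
  then have "G0 = ?D <#> (\<lambda>i. h [^] i) ` {..<k}"
    using cyclic_ext_least[OF sub D_sub h] cyclic_ext_eq[OF \<open>subgroup ?D G\<close> h_car \<open>k > 0\<close> hk] by auto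
  moreover have "(\<lambda>i. h [^] i) ` {..<k} \<subseteq> carrier G"
    using h_car by auto
  \<comment> \<open>Finite index in \<open>G0\<close> gives finite index in \<open>G\<close>, so
    that minimality of \<open>G0\<close> forces \<open>G0 \<subseteq> ?D\<close>.\<close>
  ultimately have "finite (rcosets ?D)"
    using finite_rcosets_trans[OF sub \<open>subgroup ?D G\<close> fin] by blast
  with D D_sub show ?thesis
    using least by blast
qed

lemma monogenic_imp_component:
  assumes comp: "is_definable_component M n G G0" and "monogenic M n G"
  shows "monogenic M n (G\<lparr>carrier := G0\<rparr>)" and "cyclic_group (G Mod G0)"
proof -
  have G0: "definable_subgroup M n G G0" and fin: "finite (rcosets G0)"
    and least: "\<And>K. definable_subgroup M n G K \<Longrightarrow> finite (rcosets K) \<Longrightarrow> G0 \<subseteq> K"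
    using comp by (simp_all add: is_definable_component_def)
  then have sub: "subgroup G0 G"
    by (simp add: definable_subgroup_def)
  obtain g where g: "g \<in> carrier G"
    and gen: "\<And>K. definable_subgroup M n G K \<Longrightarrow> g \<in> K \<Longrightarrow> carrier G \<subseteq> K"
    using assms(2) unfolding monogenic_iff by blast
  obtain k :: nat where k: "k > 0" and gk: "g [^] k \<in> G0"
    using finite_rcosets_pow_mem[OF sub fin g] .
  \<comment> \<open>Stated for every \<open>K\<close> because it is used twice: to show that
    \<open>K\<close> has finite index, and with \<open>G0\<close> for \<open>K\<close> to show that
    the quotient is cyclic.\<close>
  have ext: "cyclic_ext G K g = carrier G" if K: "definable_subgroup M n G K" and "g [^] k \<in> K" for K
  proof -
    have "subgroup K G"
      using K by (simp add: definable_subgroup_def)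
    then have "carrier G \<subseteq> cyclic_ext G K g"
      using gen definable_subgroup_cyclic_ext[OF K g k that(2)] mem_cyclic_ext[OF _ g] by blast
    then show ?thesis
      using subgroup.subset[OF subgroup_cyclic_ext[OF \<open>subgroup K G\<close> g]] by (rule subset_antisym[rotated])
  qed
  have "G0 \<subseteq> K" if K: "definable_subgroup M n G K" and gK: "g [^] k \<in> K" for K
  proof -
    have sub_K: "subgroup K G"
      using K by (simp add: definable_subgroup_def)
    have "carrier G = K <#> (\<lambda>i. g [^] i) ` {..<k}"
      using ext[OF K gK] cyclic_ext_eq[OF sub_K g k gK] by simp
    moreover have "(\<lambda>i. g [^] i) ` {..<k} \<subseteq> carrier G"
      using g by auto
    ultimately have "finite (rcosets K)"
      unfolding finite_rcosets_iff[OF sub_K] by blast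
    with K show ?thesis
      by (rule least)
  qed
  then show "monogenic M n (G\<lparr>carrier := G0\<rparr>)"
    unfolding monogenic_subgroup_iff[OF G0] using gk by blast
  show "cyclic_group (G Mod G0)"
    unfolding cyclic_FactGroup_iff[OF sub] using ext[OF G0 gk] g by blast
qed

lemma component_imp_monogenic:
  assumes comp: "is_definable_component M n G G0"
    and "monogenic M n (G\<lparr>carrier := G0\<rparr>)" and "cyclic_group (G Mod G0)"
  shows "monogenic M n G"
proof -
  have G0: "definable_subgroup M n G G0" and fin: "finite (rcosets G0)"
    using comp by (simp_all add: is_definable_component_def)
  then have sub: "subgroup G0 G"
    by (simp add: definable_subgroup_def)
  obtain h where h: "h \<in> G0"
    and gen: "\<And>K. definable_subgroup M n G K \<Longrightarrow> h \<in> K \<Longrightarrow> G0 \<subseteq> K"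
    using assms(2) unfolding monogenic_subgroup_iff[OF G0] by blast
  obtain g where g: "g \<in> carrier G" and ext: "cyclic_ext G G0 g = carrier G"
    using assms(3) unfolding cyclic_FactGroup_iff[OF sub] by blast
  obtain k :: nat where k: "k > 0" and gk: "g [^] k \<in> G0"
    using finite_rcosets_pow_mem[OF sub fin g] .
  \<comment> \<open>Divisibility corrects \<open>g\<close> within its coset: multiplying by the root
    \<open>u\<close> turns its \<open>k\<close>-th power into \<open>h\<close>.\<close>
  have "h \<otimes> inv (g [^] k) \<in> (\<lambda>x. x [^] k) ` G0"
    using monogenic_component_divisible[OF comp h gen k] h gk sub
    by (simp add: subgroup.m_closed subgroup.m_inv_closed)
  then obtain u where u: "u \<in> G0" and uk: "u [^] k = h \<otimes> inv (g [^] k)"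
    by auto
  have u_car: "u \<in> carrier G" and h_car: "h \<in> carrier G"
    using u h subgroup.mem_carrier[OF sub] by blast+
  have pow: "(u \<otimes> g) [^] k = h"
    using u_car h_car g by (simp add: nat_pow_distrib uk m_assoc)
  have "carrier G \<subseteq> K" if K: "definable_subgroup M n G K" and mem: "u \<otimes> g \<in> K" for K
  proof -
    have sub_K: "subgroup K G"
      using K by (simp add: definable_subgroup_def)
    have "h \<in> K"
      using subgroup_nat_pow_closed[OF sub_K mem, of k] pow by simp
    with K have "G0 \<subseteq> K"
      by (rule gen)
    \<comment> \<open>Once \<open>G0 \<subseteq> K\<close>, the correction \<open>u\<close> lies in
      \<open>K\<close> and can be cancelled to recover \<open>g\<close>.\<close>
    then have "inv u \<otimes> (u \<otimes> g) \<in> K"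
      using u subgroup.m_closed[OF sub_K subgroup.m_inv_closed[OF sub_K] mem] by blast
    then have "g \<in> K"
      using u_car g by (simp flip: m_assoc)
    then show ?thesis
      using cyclic_ext_least[OF sub_K \<open>G0 \<subseteq> K\<close>] by (simp flip: ext)
  qed
  then show ?thesis
    unfolding monogenic_iff using u_car g by blast
qed

end

text \<open>The quotient is finite, so its being monogenic is expressed by
  \<open>cyclic_group\<close>; \<open>G0\<close> enters through its characterization as the smallest
  definable subgroup of finite index.\<close>

theorem theoremE:
  fixes M :: "('f, 'r, 'a::linorder) ordered_structure"
    and n :: nat
    and G :: "'a list monoid"
    and G0 :: "'a list set"
  assumes "o_minimal M"
    and "definable_group M n G"
    and "comm_group G"
    and "is_definable_component M n G G0"
  shows "monogenic M n G \<longleftrightarrow>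
           monogenic M n (G\<lparr>carrier := G0\<rparr>) \<and> cyclic_group (G Mod G0)"
proof -
  interpret definable_comm_group G M n
    using assms(2,3) by (simp add: definable_comm_group_def definable_comm_group_axioms_def)
  show ?thesis
    using monogenic_imp_component[OF assms(4)] component_imp_monogenic[OF assms(4)] by blast
qed

end
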